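(* Let $q$ be a power of a prime $p$, $s\ge1$, and let $N>1$ be an integer with $N-1\mid q^s-1$ and $p\mid N$. Let $\Delta\subset\{0,1,\dots,N-1\}$ with $0\in\Delta$ and let $d=d(\Delta)=\max\Delta$. Assume that $d\in\mathcal{B}$ and $\mathfrak{I}_{d}\subset\Delta$. Let $\Delta'=\Delta\setminus\{d\}$ and let $t$ be the number of consecutive exponents in $(\Delta')_{\mathfrak{I}}$. Then $\mathrm{wt}\big((\mathrm{PRS}(N,\Delta)_q)^\perp\big)\ge t+1$.
   Context: Points and codes. $Y_N=\{z\in\mathbb{F}_{q^s}: z^N=z\}$, $X_N=\{(1,z): z\in Y_N\}\cup\{(0,1)\}\subset \mathbb{F}_{q^s}^2$, $\mathrm{ev}_{X_N}(f)=(f(P))_{P\in X_N}\in\mathbb{F}_{q^s}^{N+1}$ for $f\in\mathbb{F}_{q^s}[x_0,x_1]$ (with $0^0=1$). $\mathrm{PRS}(N,\Delta)$ is the $\mathbb{F}_{q^s}$-linear code spanned by $\{\mathrm{ev}_{X_N}(x_0^{d(\Delta)-i}x_1^i): i\in\Delta\}$, $\mathrm{PRS}(N,\Delta)_q=\mathrm{PRS}(N,\Delta)\cap\mathbb{F}_q^{N+1}$, $\perp$ is the Euclidean dual in $\mathbb{F}_q^{N+1}$, and $\mathrm{wt}$ is the minimum Hamming distance. Cyclotomic sets. Let $\mathbb{Z}_N=\{0\}\cup\mathbb{Z}/\langle N-1\rangle$, where the classes of $\mathbb{Z}/\langle N-1\rangle$ are represented by $\{1,\dots,N-1\}$ (so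 $0$ and $N-1$ are distinct and $q\cdot0=0$); $\mathbb{Z}_N$ is identified with $\{0,1,\dots,N-1\}$. $\mathfrak{I}_z=\{q^i\cdot z:i\ge0\}$ is the minimal cyclotomic set of $z$ with respect to $q$. $\mathcal{B}$ is the set of largest elements of the minimal cyclotomic sets. $(\Delta')_{\mathfrak{I}}$ is the union of all minimal cyclotomic sets contained in $\Delta'$. "The number $t$ of consecutive exponents" in a set means the maximal length of a run of consecutive integers contained in it. *)

theory Defs
  imports "HOL-Analysis.Analysis"
begin

definition is_subfield :: "'a::field set \<Rightarrow> bool" where
  "is_subfield K \<longleftrightarrow> 0 \<in> K \<and> 1 \<in> K \<and> (\<forall>x\<in>K. \<forall>y\<in>K. x + y \<in> K \<and> x * y \<in> K) \<and>
     (\<forall>x\<in>K. - x \<in> K \<and> inverse x \<in> K)"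

subsection \<open>Codes\<close>

definition Y_set :: "nat \<Rightarrow> 'a::field set" where
  "Y_set N = {z. z ^ N = z}"

definition X_set :: "nat \<Rightarrow> ('a::field \<times> 'a) set" where
  "X_set N = {(1, z) |z. z \<in> Y_set N} \<union> {(0, 1)}"

text \<open>An evaluation vector lists the values of a function at the points of \<open>X_set N\<close>. The
  coordinates are indexed by a finite type \<open>'n\<close>, and \<open>P\<close> is an enumeration of the points, i.e. a
  bijection from \<open>UNIV\<close> onto \<open>X_set N\<close>; so \<open>'n\<close> has \<open>card (X_set N)\<close> elements.\<close>

definition ev :: "('n::finite \<Rightarrow> 'a \<times> 'a) \<Rightarrow> ('a \<Rightarrow> 'a \<Rightarrow> 'a) \<Rightarrow> 'a::field ^ 'n" where
  "ev P f = (\<chi> j. f (fst (P j)) (snd (P j)))"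

definition PRS :: "('n::finite \<Rightarrow> 'a \<times> 'a) \<Rightarrow> nat set \<Rightarrow> ('a::field ^ 'n) set" where
  "PRS P \<Delta> = vec.span {ev P (\<lambda>x0 x1. x0 ^ (Max \<Delta> - i) * x1 ^ i) |i. i \<in> \<Delta>}"

definition subfield_subcode :: "'a set \<Rightarrow> ('a::field ^ 'n::finite) set \<Rightarrow> ('a ^ 'n) set" where
  "subfield_subcode K C = C \<inter> {c. \<forall>j. c $ j \<in> K}"

definition dual_code :: "'a set \<Rightarrow> ('a::field ^ 'n::finite) set \<Rightarrow> ('a ^ 'n) set" where
  "dual_code K C = {w. (\<forall>j. w $ j \<in> K) \<and> (\<forall>c\<in>C. (\<Sum>j\<in>UNIV. w $ j * c $ j) = 0)}"

definition hamming_dist :: "'a ^ 'n::finite \<Rightarrow> 'a ^ 'n \<Rightarrow> nat" where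
  "hamming_dist v w = card {j. v $ j \<noteq> w $ j}"

text \<open>A code with fewer than two words has minimum distance \<open>\<infinity>\<close>.\<close>

definition min_dist :: "('a ^ 'n::finite) set \<Rightarrow> enat" where
  "min_dist C = Inf {enat (hamming_dist v w) |v w. v \<in> C \<and> w \<in> C \<and> v \<noteq> w}"

subsection \<open>Cyclotomic sets\<close>

text \<open>Elements of \<open>\<int>\<^sub>N = {0} \<union> \<int>/\<langle>N - 1\<rangle>\<close> are identified with \<open>0, \<dots>, N - 1\<close>: a positive integer
  is sent to its representative modulo \<open>N - 1\<close> in \<open>{1..N - 1}\<close>, and only \<open>0\<close> is sent to \<open>0\<close>.\<close>

definition ZN_rep :: "nat \<Rightarrow> nat \<Rightarrow> nat" where
  "ZN_rep N k = (if k = 0 then 0 else (k - 1) mod (N - 1) + 1)"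

definition cyclotomic_set :: "nat \<Rightarrow> nat \<Rightarrow> nat \<Rightarrow> nat set" where
  "cyclotomic_set q N z = {ZN_rep N (q ^ i * z) |i. True}"

definition max_reps :: "nat \<Rightarrow> nat \<Rightarrow> nat set" where
  "max_reps q N = {Max (cyclotomic_set q N z) |z. z \<in> {0..N - 1}}"

definition cyclotomic_part :: "nat \<Rightarrow> nat \<Rightarrow> nat set \<Rightarrow> nat set" where
  "cyclotomic_part q N D =
     \<Union> {cyclotomic_set q N z |z. z \<in> {0..N - 1} \<and> cyclotomic_set q N z \<subseteq> D}"

definition num_consecutive :: "nat set \<Rightarrow> nat" where
  "num_consecutive S = Max {l. \<exists>a. {a..<a + l} \<subseteq> S}"

end

theory Submission
  imports Defs "HOL-Number_Theory.Cong"
begin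

text \<open>Let \<open>w\<close> be a nonzero word of the dual. If the orbit of \<open>i\<close> lies in \<open>\<Delta>'\<close>, then for each
  \<open>\<beta>\<close> the trace \<open>Tr(\<beta> z\<^sup>i)\<close> takes values in \<open>\<F>\<^sub>q\<close> and is the evaluation of a polynomial with
  exponents in \<open>\<Delta>'\<close>, whose homogenization vanishes at \<open>(0,1)\<close>. Hence \<open>Tr(\<beta> \<Sum>\<^sub>z w\<^sub>z z\<^sup>i) = 0\<close> for all
  \<open>\<beta>\<close>, and \<open>\<Sum>\<^sub>z w\<^sub>z z\<^sup>i = 0\<close> by nondegeneracy of the trace. A Vandermonde argument with \<open>t\<close>
  consecutive exponents then shows that the affine part of \<open>w\<close> is zero or has weight above \<open>t\<close>;
  the exponent \<open>0\<close> takes care of the point \<open>z = 0\<close>. Finally \<open>w\<close> is not supported at \<open>(0,1)\<close>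
  alone, because the sum of the monomials with exponents in \<open>\<II>\<^sub>d\<close> is a codeword over \<open>\<F>\<^sub>q\<close>
  with entry \<open>1\<close> there.\<close>

subsection \<open>Finite fields\<close>

text \<open>Multiplication by a nonzero \<open>x\<close> permutes the nonzero elements of
  \<open>K\<close>, so their product absorbs the factor \<open>x ^ (card K - 1)\<close>.\<close>

lemma subfield_power_card:
  fixes x :: "'a::field"
  assumes K: "is_subfield K" and fin: "finite K" and x: "x \<in> K"
  shows "x ^ card K = x"
proof (cases "x = 0")
  case True
  then show ?thesis using fin x by (auto simp: power_0_left)
next
  case False
  let ?U = "K - {0}"
  have closed: "a * b \<in> K" "inverse a \<in> K" if "a \<in> K" "b \<in> K" for a b
    using K that by (auto simp: is_subfield_def)
  have bij: "bij_betw ((*) x) ?U ?U"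
  proof (rule bij_betw_byWitness[where f' = "(*) (inverse x)"])
    show "(*) x ` ?U \<subseteq> ?U" "(*) (inverse x) ` ?U \<subseteq> ?U"
      using False x closed by auto
  qed (use False in auto)
  have "prod id ?U = (\<Prod>y\<in>?U. x * y)"
    using prod.reindex_bij_betw[OF bij, of id] by simp
  also have "\<dots> = x ^ card ?U * prod id ?U"
    by (simp add: prod.distrib)
  finally have "x ^ card ?U = 1"
    using fin by simp
  moreover have "card K = Suc (card ?U)"
    using fin K by (metis card_Suc_Diff1 is_subfield_def)
  ultimately show ?thesis by simp
qed

text \<open>The polynomial \<open>X^q - X\<close> has at most \<open>q\<close> roots and
  \<open>K\<close> already supplies \<open>q\<close> of them. Membership in \<open>K\<close> thus
  becomes an equation that can be checked by applying Frobenius.\<close>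

lemma subfield_eq_power_fixed:
  fixes K :: "'a::field set"
  assumes K: "is_subfield K" and fin: "finite K"
  shows "K = {x. x ^ card K = x}"
proof -
  let ?q = "card K"
  let ?g = "monom (1::'a) ?q - monom 1 1"
  have "{0, 1} \<subseteq> K" using K by (auto simp: is_subfield_def)
  then have "card {0, 1 :: 'a} \<le> ?q" using fin card_mono by blast
  then have q: "?q > 1" by simp
  have "coeff ?g ?q = 1" using q by simp
  then have nz: "?g \<noteq> 0" by (metis coeff_0 zero_neq_one)
  let ?F = "{x::'a. x ^ ?q = x}"
  have roots: "?F = {x. poly ?g x = 0}"
    by (auto simp: poly_monom)
  have "degree ?g \<le> ?q"
    using q by (intro degree_diff_le degree_monom_le order_trans[OF degree_monom_le]) auto
  then have "card ?F \<le> ?q"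
    unfolding roots using card_poly_roots_bound[OF nz] by linarith
  moreover have "finite ?F" unfolding roots using nz by (rule poly_roots_finite)
  moreover have "K \<subseteq> ?F" using subfield_power_card[OF K fin] by blast
  ultimately show ?thesis by (intro card_seteq)
qed

lemma CHAR_eq_of_CARD_prime_power:
  assumes "prime p" and "CARD('a::{field,finite}) = p ^ n"
  shows "CHAR('a) = p"
proof -
  have "prime CHAR('a)"
    by (rule prime_CHAR_semidom) (simp add: finite_imp_CHAR_pos)
  moreover have "(of_nat CARD('a) :: 'a) = 0"
  proof -
    \<comment> \<open>Translation by 1 permutes the field; comparing the two sums leaves
      \<open>CARD('a) = 0\<close> in the field.\<close>
    have "(\<Sum>x\<in>UNIV. x :: 'a) = (\<Sum>x\<in>UNIV. x + 1)"
      by (rule sum.reindex_bij_witness[of _ "\<lambda>x. x + 1" "\<lambda>x. x - 1"]) simp_all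
    then show ?thesis by (simp add: sum.distrib)
  qed
  then have "CHAR('a) dvd p ^ n"
    using assms(2) by (simp only: of_nat_eq_0_iff_char_dvd)
  ultimately show ?thesis
    using assms(1) prime_dvd_power primes_dvd_imp_eq by blast
qed

text \<open>In a field with \<open>q ^ s\<close> elements this is the trace to the subfield of order
  \<open>q\<close>, written as the sum of conjugates.\<close>

definition field_trace :: "nat \<Rightarrow> nat \<Rightarrow> 'a::field \<Rightarrow> 'a" where
  "field_trace q s x = (\<Sum>j<s. x ^ q ^ j)"

text \<open>As a polynomial the trace has degree at most \<open>q ^ (s - 1)\<close>, too small to
  vanish on the whole field. This is the source of nondegeneracy.\<close>

lemma field_trace_nonzero:
  assumes card: "CARD('a::{field,finite}) = q ^ s" and s: "s \<ge> 1"
  shows "\<exists>x::'a. field_trace q s x \<noteq> 0"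
proof (rule ccontr)
  assume "\<not> ?thesis"
  then have all0: "field_trace q s x = 0" for x :: 'a by blast
  let ?g = "\<Sum>j<s. monom (1::'a) (q ^ j)"
  have "CARD('a) > 1"
    using card_mono[of "UNIV :: 'a set" "{0, 1}"] by simp
  then have "q \<noteq> 0" "q \<noteq> 1" using card s by (intro notI; simp add: power_0_left)+
  then have q: "q > 1" by simp
  have "coeff ?g (q ^ (s - 1)) = (\<Sum>j<s. if j = s - 1 then 1 else 0)"
    using q by (auto simp: coeff_sum intro!: sum.cong)
  also have "\<dots> = 1" using s by simp
  finally have nz: "?g \<noteq> 0" by (metis coeff_0 zero_neq_one)
  have "degree ?g \<le> q ^ (s - 1)"
    using q by (intro degree_sum_le order_trans[OF degree_monom_le] power_increasing) auto
  moreover have "{x. poly ?g x = 0} = UNIV"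
    using all0 by (auto simp: poly_sum poly_monom field_trace_def)
  ultimately have "CARD('a) \<le> q ^ (s - 1)"
    using card_poly_roots_bound[OF nz] by simp
  moreover have "q ^ (s - 1) < q ^ s" using q s by simp
  ultimately show False using card by simp
qed

text \<open>Frobenius shifts the conjugates cyclically, because \<open>x ^ q ^ s = x\<close>; hence
  traces are fixed by the \<open>q\<close>-th power.\<close>

lemma field_trace_power:
  fixes x :: "'a::{field,finite}"
  assumes "prime p" and q: "q = p ^ m" and card: "CARD('a) = q ^ s"
  shows "field_trace q s x ^ q = field_trace q s x"
proof -
  have char: "CHAR('a) = p"
    using assms CHAR_eq_of_CARD_prime_power[of p "m * s"] by (simp add: power_mult)
  have "field_trace q s x ^ q = (\<Sum>j<s. x ^ q ^ Suc j)"
    unfolding field_trace_def using assms char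
    by (subst freshmans_dream_sum'[of _ m]) (simp_all flip: power_mult add: mult.commute)
  also have "\<dots> = field_trace q s x + (x ^ q ^ s - x)"
    unfolding field_trace_def using sum.lessThan_Suc_shift[of "\<lambda>j. x ^ q ^ j" s]
    by (simp add: algebra_simps)
  also have "x ^ q ^ s = x"
    using subfield_power_card[of UNIV x] card by (simp add: is_subfield_def)
  finally show ?thesis by simp
qed

lemma field_trace_sum:
  fixes f :: "'b \<Rightarrow> 'a::{field,finite}"
  assumes "prime p" and q: "q = p ^ m" and card: "CARD('a) = q ^ s"
  shows "field_trace q s (sum f A) = (\<Sum>x\<in>A. field_trace q s (f x))"
proof -
  have char: "CHAR('a) = p"
    using assms CHAR_eq_of_CARD_prime_power[of p "m * s"] by (simp add: power_mult)
  have "sum f A ^ q ^ j = (\<Sum>x\<in>A. f x ^ q ^ j)" for j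
    using assms char by (intro freshmans_dream_sum'[of _ "m * j"]) (simp_all add: power_mult)
  then show ?thesis
    unfolding field_trace_def by (simp add: sum.swap[of _ A])
qed

lemma power_power_fixed:
  fixes x :: "'a::monoid_mult"
  assumes "x ^ q = x"
  shows "x ^ q ^ j = x"
  by (induction j) (simp_all add: assms power_mult)

lemma field_trace_scale:
  assumes "c ^ q = c"
  shows "field_trace q s (c * x) = c * field_trace q s x"
  by (simp add: field_trace_def power_mult_distrib power_power_fixed[OF assms] sum_distrib_left)

subsection \<open>Vandermonde systems\<close>

lemma power_sums_zero_imp_zero:
  fixes w x :: "'b \<Rightarrow> 'a::field"
  assumes fin: "finite S" and card: "card S \<le> t" and inj: "inj_on x S"
    and zero: "\<And>i. i \<in> {a..<a + t} \<Longrightarrow> (\<Sum>j\<in>S. w j * x j ^ i) = 0"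
    and k: "k \<in> S" "a = 0 \<or> x k \<noteq> 0"
  shows "w k = 0"
proof -
  \<comment> \<open>Combining the power sums with the coefficients of \<open>g\<close> isolates the
    summand at \<open>k\<close>, since \<open>g\<close> vanishes at every other node and has degree
    below \<open>t\<close>.\<close>
  define g where "g = (\<Prod>j\<in>S - {k}. [:- x j, 1:])"
  have "degree g = card (S - {k})"
    unfolding g_def by (subst degree_prod_eq_sum_degree) auto
  also have "\<dots> < card S" using fin k(1) by (intro psubset_card_mono) auto
  finally have deg: "degree g < t" using card by simp
  have "(\<Sum>j\<in>S. w j * x j ^ a * poly g (x j)) =
      (\<Sum>j\<in>S. \<Sum>i\<le>degree g. coeff g i * (w j * x j ^ (a + i)))"
    by (simp add: poly_altdef sum_distrib_left power_add mult_ac)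
  also have "\<dots> = (\<Sum>i\<le>degree g. coeff g i * (\<Sum>j\<in>S. w j * x j ^ (a + i)))"
    by (subst sum.swap) (simp add: sum_distrib_left)
  also have "\<dots> = 0" using deg by (intro sum.neutral) (auto simp: zero)
  finally have "(\<Sum>j\<in>S. w j * x j ^ a * poly g (x j)) = 0" .
  moreover have "(\<Sum>j\<in>S. w j * x j ^ a * poly g (x j)) = w k * x k ^ a * poly g (x k)"
  proof (subst sum.remove[OF fin k(1)], subst sum.neutral)
    show "\<forall>j\<in>S - {k}. w j * x j ^ a * poly g (x j) = 0"
    proof
      fix j assume "j \<in> S - {k}"
      then have "poly g (x j) = 0"
        unfolding g_def poly_prod using fin by (subst prod_zero_iff) auto
      then show "w j * x j ^ a * poly g (x j) = 0" by simp
    qed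
  qed simp
  moreover have "poly g (x k) \<noteq> 0"
    unfolding g_def poly_prod using fin inj k(1) by (auto simp: inj_on_def)
  moreover have "x k ^ a \<noteq> 0" using k(2) by auto
  ultimately show ?thesis by (metis mult_eq_0_iff)
qed

subsection \<open>Cyclotomic sets\<close>

text \<open>A nonzero \<open>z\<close> satisfies \<open>z ^ (N - 1) = 1\<close>. At
  \<open>z = 0\<close> it matters that reduction keeps positive exponents positive.\<close>

lemma power_ZN_rep:
  fixes z :: "'a::field"
  assumes z: "z \<in> Y_set N" and N: "N > 1"
  shows "z ^ ZN_rep N k = z ^ k"
proof (cases "k = 0 \<or> z = 0")
  case True
  then show ?thesis by (auto simp: ZN_rep_def power_0_left)
next
  case False
  have "z * z ^ (N - 1) = z * 1"
    using z N by (simp add: Y_set_def flip: power_Suc)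
  then have one: "z ^ (N - 1) = 1" using False by simp
  have "z ^ (k - 1) = z ^ ((N - 1) * ((k - 1) div (N - 1)) + (k - 1) mod (N - 1))"
    by simp
  also have "\<dots> = z ^ ((k - 1) mod (N - 1))"
    unfolding power_add power_mult one by simp
  finally have "z ^ (k - 1 + 1) = z ^ ((k - 1) mod (N - 1) + 1)" by (simp only: power_add)
  moreover have "k - 1 + 1 = k" "ZN_rep N k = (k - 1) mod (N - 1) + 1"
    using False by (simp_all add: ZN_rep_def)
  ultimately show ?thesis by simp
qed

text \<open>Positivity is essential: 0 and \<open>N - 1\<close> are congruent but have different
  representatives.\<close>

lemma ZN_rep_cong:
  assumes "k > 0" "l > 0" "[k = l] (mod (N - 1))"
  shows "ZN_rep N k = ZN_rep N l"
proof -
  have "[k - 1 + 1 = l - 1 + 1] (mod (N - 1))" using assms by simp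
  then have "[k - 1 = l - 1] (mod (N - 1))" by (simp only: cong_add_rcancel_nat)
  then show ?thesis using assms by (simp add: ZN_rep_def cong_def)
qed

lemma cong_ZN_rep: "[ZN_rep N k = k] (mod (N - 1))"
proof (cases "k = 0")
  case False
  have "[(k - 1) mod (N - 1) + 1 = k - 1 + 1] (mod (N - 1))"
    by (intro cong_add) simp_all
  then show ?thesis using False by (simp add: ZN_rep_def)
qed (simp add: ZN_rep_def)

lemma ZN_rep_pos_iff [simp]: "ZN_rep N k > 0 \<longleftrightarrow> k > 0"
  by (simp add: ZN_rep_def)

lemma ZN_rep_mult_ZN_rep: "ZN_rep N (c * ZN_rep N k) = ZN_rep N (c * k)"
proof (cases "c * k = 0")
  case True
  then show ?thesis by (auto simp: ZN_rep_def)
next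
  case False
  show ?thesis
  proof (rule ZN_rep_cong)
    show "[c * ZN_rep N k = c * k] (mod (N - 1))"
      by (rule cong_mult[OF cong_refl cong_ZN_rep])
  qed (use False in simp_all)
qed

lemma ZN_rep_ident: "k \<le> N - 1 \<Longrightarrow> ZN_rep N k = k"
  by (cases k) (auto simp: ZN_rep_def)

lemma ZN_rep_le:
  assumes "N > 1"
  shows "ZN_rep N k \<le> N - 1"
proof -
  have "(k - 1) mod (N - 1) < N - 1" using assms by simp
  then show ?thesis by (simp add: ZN_rep_def)
qed

lemma finite_cyclotomic_set:
  assumes "N > 1"
  shows "finite (cyclotomic_set q N z)"
proof (rule finite_subset)
  show "cyclotomic_set q N z \<subseteq> {..N - 1}"
    using ZN_rep_le[OF assms] by (auto simp: cyclotomic_set_def)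
qed simp

lemma cyclotomic_set_closed:
  assumes "i \<in> cyclotomic_set q N z"
  shows "ZN_rep N (q ^ j * i) \<in> cyclotomic_set q N z"
proof -
  obtain k where "i = ZN_rep N (q ^ k * z)"
    using assms by (auto simp: cyclotomic_set_def)
  then have "ZN_rep N (q ^ j * i) = ZN_rep N (q ^ (j + k) * z)"
    by (simp add: ZN_rep_mult_ZN_rep power_add mult.assoc)
  then show ?thesis unfolding cyclotomic_set_def by blast
qed

lemma cyclotomic_part_closed:
  assumes "i \<in> cyclotomic_part q N D"
  shows "ZN_rep N (q ^ j * i) \<in> D"
proof -
  obtain z where "i \<in> cyclotomic_set q N z" "cyclotomic_set q N z \<subseteq> D"
    using assms by (auto simp: cyclotomic_part_def)
  then show ?thesis using cyclotomic_set_closed by blast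
qed

lemma cyclotomic_part_subset: "cyclotomic_part q N D \<subseteq> D"
  by (auto simp: cyclotomic_part_def)

lemma self_in_cyclotomic_set:
  assumes "z \<le> N - 1"
  shows "z \<in> cyclotomic_set q N z"
proof -
  have "z = ZN_rep N (q ^ 0 * z)" using ZN_rep_ident[OF assms] by simp
  then show ?thesis unfolding cyclotomic_set_def by blast
qed

lemma zero_in_cyclotomic_part:
  assumes "0 \<in> D"
  shows "0 \<in> cyclotomic_part q N D"
proof -
  have "cyclotomic_set q N 0 \<subseteq> D"
    using assms by (auto simp: cyclotomic_set_def ZN_rep_def)
  then have "cyclotomic_set q N 0 \<subseteq> cyclotomic_part q N D"
    unfolding cyclotomic_part_def by (intro Union_upper CollectI exI[of _ 0]) simp
  then show ?thesis using self_in_cyclotomic_set[of 0 N q] by blast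
qed

text \<open>Since \<open>q ^ s\<close> is 1 modulo \<open>N - 1\<close>, going \<open>s - 1\<close>
  steps forward in an orbit undoes one step. So the map is surjective on a finite set, hence
  bijective.\<close>

lemma bij_betw_cyclotomic_set:
  assumes N: "N > 1" and dvd: "(N - 1) dvd (q ^ s - 1)" and q: "q \<ge> 1" and s: "s \<ge> 1"
  shows "bij_betw (\<lambda>k. ZN_rep N (q * k)) (cyclotomic_set q N z) (cyclotomic_set q N z)"
proof -
  let ?I = "cyclotomic_set q N z" and ?f = "\<lambda>k. ZN_rep N (q * k)"
  have "?I \<subseteq> ?f ` ?I"
  proof
    fix k assume "k \<in> ?I"
    then obtain i where k: "k = ZN_rep N (q ^ i * z)" by (auto simp: cyclotomic_set_def)
    show "k \<in> ?f ` ?I"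
    proof
      show "ZN_rep N (q ^ (i + (s - 1)) * z) \<in> ?I" by (auto simp: cyclotomic_set_def)
      have "[1 = q ^ s] (mod (N - 1))"
        using dvd q by (subst cong_sym_eq) (simp add: cong_altdef_nat)
      then have "[1 * (q ^ i * z) = q ^ s * (q ^ i * z)] (mod (N - 1))"
        by (intro cong_mult) simp_all
      then have "k = ZN_rep N (q ^ s * (q ^ i * z))"
        using q unfolding k by (cases "z = 0") (auto intro!: ZN_rep_cong)
      also have "q ^ s * (q ^ i * z) = q * (q ^ (i + (s - 1)) * z)"
        using s by (cases s) (simp_all add: power_add mult_ac)
      finally show "k = ?f (ZN_rep N (q ^ (i + (s - 1)) * z))"
        by (simp add: ZN_rep_mult_ZN_rep)
    qed
  qed
  moreover have "?f ` ?I \<subseteq> ?I" using cyclotomic_set_closed[of _ q N z 1] by auto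
  ultimately have "?f ` ?I = ?I" by blast
  then show ?thesis
    using finite_cyclotomic_set[OF N] by (simp add: bij_betw_def eq_card_imp_inj_on)
qed

lemma num_consecutive_run:
  assumes "finite S"
  obtains a where "{a..<a + num_consecutive S} \<subseteq> S"
proof -
  let ?L = "{l. \<exists>a. {a..<a + l} \<subseteq> S}"
  have "?L \<subseteq> {..card S}"
  proof
    fix l assume "l \<in> ?L"
    then obtain a where "{a..<a + l} \<subseteq> S" by (elim CollectE exE)
    from card_mono[OF assms this] show "l \<in> {..card S}" by simp
  qed
  then have "finite ?L" by (rule finite_subset) simp
  moreover have "?L \<noteq> {}"
  proof -
    have "{0..<0 + 0} \<subseteq> S" by simp
    then have "0 \<in> ?L" by (intro CollectI exI)
    then show ?thesis by (metis empty_iff)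
  qed
  ultimately have "Max ?L \<in> ?L" by (rule Max_in)
  then obtain a where "{a..<a + Max ?L} \<subseteq> S" by (elim CollectE exE)
  then show ?thesis by (intro that[of a]) (simp only: num_consecutive_def)
qed

subsection \<open>Codewords and the minimum distance\<close>

text \<open>Indexing exponents by \<open>e\<close> allows repetitions, which occur in a trace when
  the orbit is shorter than \<open>s\<close>.\<close>

lemma sum_monomials_in_PRS:
  assumes "\<And>k. k \<in> T \<Longrightarrow> e k \<in> \<Delta>"
  shows "(\<Sum>k\<in>T. c k *s ev P (\<lambda>x0 x1. x0 ^ (Max \<Delta> - e k) * x1 ^ e k)) \<in> PRS P \<Delta>"
  unfolding PRS_def using assms by (intro vec.span_sum vec.span_scale vec.span_base) blast

text \<open>By linearity, distances are weights of differences. A code without two distinct words is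
  covered by the infimum of the empty set.\<close>

lemma min_dist_dual_code_ge:
  assumes K: "is_subfield K"
    and wt: "\<And>u. u \<in> dual_code K C \<Longrightarrow> u \<noteq> 0 \<Longrightarrow> r \<le> card {j. u $ j \<noteq> 0}"
  shows "enat r \<le> min_dist (dual_code K C)"
  unfolding min_dist_def
proof (rule Inf_greatest, clarify)
  fix v w assume v: "v \<in> dual_code K C" and w: "w \<in> dual_code K C" and ne: "v \<noteq> w"
  have "v $ j - w $ j \<in> K" for j
  proof -
    have "v $ j + - (w $ j) \<in> K"
      using v w K unfolding dual_code_def is_subfield_def by blast
    then show ?thesis by simp
  qed
  then have "v - w \<in> dual_code K C"
    using v w by (simp add: dual_code_def left_diff_distrib sum_subtractf)
  then have "r \<le> card {j. (v - w) $ j \<noteq> 0}" using wt[of "v - w"] ne by simp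
  then show "enat r \<le> enat (hamming_dist v w)" by (simp add: hamming_dist_def)
qed

theorem proposition4p17:
  fixes p m q s N d t :: nat
    and K :: "'a::{field,finite} set"
    and P :: "'n::finite \<Rightarrow> 'a \<times> 'a"
    and \<Delta> \<Delta>' :: "nat set"
  assumes "prime p" and "m \<ge> 1" and "q = p ^ m" and "s \<ge> 1"
    and "CARD('a) = q ^ s"
    and "is_subfield K" and "card K = q"
    and "N > 1" and "(N - 1) dvd (q ^ s - 1)" and "p dvd N"
    and "bij_betw P UNIV (X_set N)"
    and "\<Delta> \<subseteq> {0..N - 1}" and "0 \<in> \<Delta>"
    and "d = Max \<Delta>"
    and "d \<in> max_reps q N"
    and "cyclotomic_set q N d \<subseteq> \<Delta>"
    and "\<Delta>' = \<Delta> - {d}"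
    and "t = num_consecutive (cyclotomic_part q N \<Delta>')"
  shows "min_dist (dual_code K (subfield_subcode K (PRS P \<Delta>))) \<ge> enat (t + 1)"
proof -
  have q: "q > 1" using assms(1-3) by (metis One_nat_def one_less_power prime_gt_1_nat Suc_le_eq)
  have fixed: "K = {x. x ^ q = x}"
    using subfield_eq_power_fixed[OF assms(6)] assms(7) by simp
  have inj: "inj P" and range: "range P = X_set N"
    using assms(11) by (auto simp: bij_betw_def)
  have "(0, 1) \<in> range P" unfolding range X_set_def by simp
  then obtain \<omega> where inf: "P \<omega> = (0, 1)" by (metis rangeE)
  \<comment> \<open>\<open>\<omega>\<close> indexes the point at infinity, \<open>A\<close> the
    affine points.\<close>
  define A where "A = UNIV - {\<omega>}"
  define x where "x j = snd (P j)" for j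
  have aff: "P j = (1, x j)" "x j \<in> Y_set N" if "j \<in> A" for j
  proof -
    have "P j \<in> X_set N" using range by blast
    moreover have "P j \<noteq> (0, 1)"
      using that inj_eq[OF inj, of j \<omega>] inf by (simp add: A_def)
    ultimately show "P j = (1, x j)" "x j \<in> Y_set N" by (auto simp: X_set_def x_def)
  qed
  have inj_x: "inj_on x A"
  proof (rule inj_onI)
    fix i j assume "i \<in> A" "j \<in> A" "x i = x j"
    then have "P i = P j" by (simp add: aff)
    then show "i = j" by (rule injD[OF inj])
  qed
  have split: "(\<Sum>j\<in>UNIV. f j) = f \<omega> + (\<Sum>j\<in>A. f j)" for f :: "'n \<Rightarrow> 'a"
    unfolding A_def by (intro sum.remove) auto
  have fin: "finite \<Delta>" using assms(12) finite_subset by blast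
  have le_d: "k \<le> d" if "k \<in> \<Delta>" for k using fin that assms(14) by simp
  have d: "d \<in> \<Delta>" using fin assms(13,14) Max_in by blast
  define b where "b k = ev P (\<lambda>x0 x1. x0 ^ (Max \<Delta> - k) * x1 ^ k)" for k
  have b_aff: "b k $ j = x j ^ k" if "j \<in> A" for j k
    using aff[OF that] by (simp add: b_def ev_def)
  \<comment> \<open>The entry is \<open>0 ^ (d - k)\<close>, which is 1 only through
    \<open>0 ^ 0\<close>.\<close>
  have b_inf: "b k $ \<omega> = (if k = d then 1 else 0)" if "k \<in> \<Delta>" for k
    using inf le_d[OF that] assms(14) by (auto simp: b_def ev_def power_0_left)
  show ?thesis
  proof (rule min_dist_dual_code_ge[OF assms(6)])
    fix u assume u: "u \<in> dual_code K (subfield_subcode K (PRS P \<Delta>))" and "u \<noteq> 0"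
    have uK: "u $ j ^ q = u $ j" for j using u fixed by (auto simp: dual_code_def)
    have ortho: "(\<Sum>j\<in>UNIV. u $ j * c $ j) = 0" if "c \<in> PRS P \<Delta>" "\<And>j. c $ j ^ q = c $ j" for c
      using u that fixed by (auto simp: dual_code_def subfield_subcode_def)
    define I where "I = cyclotomic_set q N d"
    \<comment> \<open>Summing over a full orbit makes the affine entries Frobenius-stable, and
      \<open>d\<close> alone contributes at infinity.\<close>
    define c where "c = (\<Sum>k\<in>I. 1 *s b k)"
    have finI: "finite I" unfolding I_def using assms(8) by (rule finite_cyclotomic_set)
    have "d \<in> {0..N - 1}" using d assms(12) by blast
    then have dI: "d \<in> I" unfolding I_def by (intro self_in_cyclotomic_set) simp
    have c_PRS: "c \<in> PRS P \<Delta>"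
      unfolding c_def b_def using assms(16) by (intro sum_monomials_in_PRS) (auto simp: I_def)
    have c_aff: "c $ j = (\<Sum>k\<in>I. x j ^ k)" if "j \<in> A" for j
      unfolding c_def by (simp add: b_aff that)
    have "c $ \<omega> = (\<Sum>k\<in>I. if k = d then 1 else 0)"
      unfolding c_def sum_component using assms(16) by (intro sum.cong) (auto simp: b_inf I_def)
    then have c_inf: "c $ \<omega> = 1" using finI dI by simp
    have char: "CHAR('a) = p"
      using assms(1,3,5) CHAR_eq_of_CARD_prime_power[of p "m * s"] by (simp add: power_mult)
    have c_K: "c $ j ^ q = c $ j" for j
    proof (cases "j \<in> A")
      case True
      have "c $ j ^ q = (\<Sum>k\<in>I. (x j ^ k) ^ q)"
        unfolding c_aff[OF True] using assms(1,3) char by (intro freshmans_dream_sum'[of _ m]) simp_all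
      also have "\<dots> = (\<Sum>k\<in>I. x j ^ ZN_rep N (q * k))"
        using power_ZN_rep[OF aff(2)[OF True] assms(8)] by (simp flip: power_mult add: mult.commute)
      also have "\<dots> = (\<Sum>k\<in>I. x j ^ k)"
        unfolding I_def using assms q
        by (intro sum.reindex_bij_betw bij_betw_cyclotomic_set[where s = s]) auto
      finally show ?thesis by (simp add: c_aff[OF True])
    next
      case False
      then show ?thesis using c_inf by (simp add: A_def)
    qed
    have aff_nonzero: "\<exists>j\<in>A. u $ j \<noteq> 0"
    proof (rule ccontr)
      assume "\<not> ?thesis"
      then have z: "u $ j = 0" if "j \<in> A" for j using that by blast
      then have "u $ \<omega> = 0" using ortho[OF c_PRS c_K] by (simp add: split c_inf)
      then have "u $ j = 0" for j using z by (cases "j \<in> A") (auto simp: A_def)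
      then show False using \<open>u \<noteq> 0\<close> by (simp add: vec_eq_iff)
    qed
    define S where "S = cyclotomic_part q N \<Delta>'"
    have power_sum: "(\<Sum>j\<in>A. u $ j * x j ^ i) = 0" (is "?y = 0") if i: "i \<in> S" for i
    proof (rule ccontr)
      assume "?y \<noteq> 0"
      have e: "ZN_rep N (q ^ r * i) \<in> \<Delta>'" for r
        using i unfolding S_def by (rule cyclotomic_part_closed)
      have "field_trace q s (\<beta> * ?y) = 0" for \<beta>
      proof -
        \<comment> \<open>The conjugates of \<open>\<beta> * z ^ i\<close>, with exponents reduced
          into \<open>\<Delta>'\<close>; as these avoid \<open>d\<close>, the entry at infinity is
          0.\<close>
        define v where "v = (\<Sum>r<s. \<beta> ^ q ^ r *s b (ZN_rep N (q ^ r * i)))"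
        have v_PRS: "v \<in> PRS P \<Delta>"
          unfolding v_def b_def using e assms(17) by (intro sum_monomials_in_PRS) auto
        have v_aff: "v $ j = field_trace q s (\<beta> * x j ^ i)" if "j \<in> A" for j
          using power_ZN_rep[OF aff(2)[OF that] assms(8)]
          by (simp add: v_def field_trace_def b_aff that power_mult_distrib mult.commute flip: power_mult)
        have v_inf: "v $ \<omega> = 0"
          unfolding v_def sum_component using e assms(17) by (intro sum.neutral) (auto simp: b_inf)
        have "v $ j ^ q = v $ j" for j
          using v_inf q v_aff field_trace_power[OF assms(1,3,5)]
          by (cases "j \<in> A") (auto simp: A_def)
        then have "0 = (\<Sum>j\<in>A. u $ j * field_trace q s (\<beta> * x j ^ i))"
          using ortho[OF v_PRS] by (simp add: split v_inf v_aff)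
        \<comment> \<open>The entries of \<open>u\<close> lie in \<open>K\<close>, so they pass
          inside the trace.\<close>
        also have "\<dots> = (\<Sum>j\<in>A. field_trace q s (\<beta> * (u $ j * x j ^ i)))"
          by (simp add: field_trace_scale[OF uK, symmetric] mult_ac)
        also have "\<dots> = field_trace q s (\<beta> * ?y)"
          by (simp add: field_trace_sum[OF assms(1,3,5)] sum_distrib_left)
        finally show ?thesis by simp
      qed
      \<comment> \<open>Taking \<open>\<beta> = z / ?y\<close> would make the trace vanish
        identically.\<close>
      from this[of "z / ?y" for z] have "field_trace q s z = 0" for z :: 'a
        using \<open>?y \<noteq> 0\<close> by simp
      then show False using field_trace_nonzero[OF assms(5,4)] by blast
    qed
    show "t + 1 \<le> card {j. u $ j \<noteq> 0}"
    proof (rule ccontr)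
      assume "\<not> ?thesis"
      then have few: "card {j. u $ j \<noteq> 0} \<le> t" by simp
      have "finite S"
        using cyclotomic_part_subset fin assms(17) unfolding S_def by (metis finite_Diff finite_subset)
      then obtain a where a: "{a..<a + t} \<subseteq> S"
        using num_consecutive_run assms(18) S_def by metis
      have "card {j. u $ j \<noteq> 0} > 0" using aff_nonzero by (auto simp: card_gt_0_iff)
      then have "t > 0" using few by simp
      then have "a \<in> \<Delta>'" using a cyclotomic_part_subset unfolding S_def by force
      \<comment> \<open>\<open>a\<close> lies in \<open>\<Delta>'\<close>, hence strictly below the
        maximum \<open>d\<close>; so 0 survives the removal of \<open>d\<close>.\<close>
      then have "d \<noteq> 0" using le_d assms(17) by fastforce
      then have "0 \<in> S" unfolding S_def using assms(13,17) by (intro zero_in_cyclotomic_part) auto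
      \<comment> \<open>For \<open>a > 0\<close> the Vandermonde argument does not reach the node 0,
        which is treated separately below.\<close>
      have z: "u $ k = 0" if k: "k \<in> A" "a = 0 \<or> x k \<noteq> 0" for k
      proof (rule ccontr)
        assume nz: "u $ k \<noteq> 0"
        let ?T = "{j \<in> A. u $ j \<noteq> 0}"
        have "card ?T \<le> t" using few card_mono[of "{j. u $ j \<noteq> 0}" ?T] by fastforce
        moreover have "inj_on x ?T" using inj_x by (rule inj_on_subset) auto
        moreover have "(\<Sum>j\<in>?T. u $ j * x j ^ i) = 0" if "i \<in> {a..<a + t}" for i
        proof -
          have "(\<Sum>j\<in>?T. u $ j * x j ^ i) = (\<Sum>j\<in>A. u $ j * x j ^ i)"
            by (intro sum.mono_neutral_left) auto
          then show ?thesis using power_sum a that by auto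
        qed
        ultimately have "u $ k = 0"
          using power_sums_zero_imp_zero[of ?T t x a "\<lambda>j. u $ j" k] nz k by simp
        with nz show False ..
      qed
      obtain k where k: "k \<in> A" "u $ k \<noteq> 0" using aff_nonzero by blast
      \<comment> \<open>Only the node 0 can carry affine support. By injectivity of \<open>x\<close>
        it is a single coordinate, and the power sum with exponent 0 equals its entry.\<close>
      with z have "x k = 0" by blast
      then have "u $ j = 0" if "j \<in> A" "j \<noteq> k" for j
        using z k(1) inj_x that by (metis inj_onD)
      then have "(\<Sum>j\<in>A. u $ j * x j ^ 0) = u $ k"
        using sum.remove[of A k "\<lambda>j. u $ j"] k(1) by (simp add: sum.neutral)
      then show False using power_sum[OF \<open>0 \<in> S\<close>] k(2) by simp
    qed
  qed
qed

end
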